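(* Let $p=1$ and $A=[0,\infty)$, i.e. the parameter space is $\{\theta=(\theta_1,\theta_2)\in\mathbb{R}^2:\theta_1\ge\theta_2\}$. Let $\hat q_{\pi_{U,A}}$ and $\hat q_{\mathrm{mre}}$ be constructed with the nominal variances $\sigma_1^2,\sigma_2^2,\sigma_Y^2>0$, and suppose that the variances are misspecified, the true variances being $\mathbb{V}(X_1)=a_1^2\sigma_1^2$, $\mathbb{V}(X_2)=a_2^2\sigma_2^2$, $\mathbb{V}(Y_1)=a_Y^2\sigma_Y^2$ (with $a_1^2,a_2^2,a_Y^2>0$). For estimating the density of $Y_1$ under Kullback-Leibler loss, the Bayes predictive density $\hat q_{\pi_{U,A}}$ dominates the minimum risk equivariant predictive density estimator $\hat q_{\mathrm{mre}}$ whenever $\sigma_U^2\le\sigma_V^2$, where $$\sigma_U^2=\frac{a_2^2\sigma_2^2+(1-\beta)^2a_1^2\sigma_1^2+\beta^2a_Y^2\sigma_Y^2}{\sigma_2^2+\beta\sigma_Y^2},\qquad \sigma_V^2=\frac{a_1^2\sigma_1^2+a_2^2\sigma_2^2}{\sigma_1^2+\sigma_2^2},\qquad \beta=\frac{\sigma_1^2}{\sigma_1^2+\sigma_Y^2}.$$ In particular, dominance occurs in each of the cases: (i) $a_1^2=a_2^2=a_Y^2$; (ii) $a_Y^2\le a_1^2=a_2^2$; (iii) $\sigma_1^2=\sigma_2^2=\sigma_Y^2$ and $\frac{a_2^2+a_Y^2}{2}\le a_1^2$.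
   Context: Nominal model (used only to construct the predictive densities): $X_1\sim N(\theta_1,\sigma_1^2)$, $X_2\sim N(\theta_2,\sigma_2^2)$, $Y_1\sim N(\theta_1,\sigma_Y^2)$ independent, $X=(X_1,X_2)$, with $\theta_1-\theta_2\in A$. The predictive density $\hat q_{\mathrm{mre}}(\cdot;X)$ is the $N(X_1,\sigma_1^2+\sigma_Y^2)$ density. $\hat q_{\pi_{U,A}}$ is the Bayes predictive density under Kullback-Leibler loss for the uniform prior $\pi_{U,A}(\theta)=\mathbb{I}_A(\theta_1-\theta_2)$, i.e. the posterior predictive density $\int q^{\mathrm{nom}}_{\theta_1}(y_1)\,\pi(\theta\mid x)\,d\theta$ computed in the nominal model, $q^{\mathrm{nom}}_{\theta_1}$ being the $N(\theta_1,\sigma_Y^2)$ density. True model (used to assess risk): $X_1\sim N(\theta_1,a_1^2\sigma_1^2)$, $X_2\sim N(\theta_2,a_2^2\sigma_2^2)$, $Y_1\sim N(\theta_1,a_Y^2\sigma_Y^2)$ independent. With $q_{\theta_1}$ the true density of $Y_1$, the Kullback-Leibler risk of $\hat q$ is $R_{KL}(\theta,\hat q)=\mathbb{E}_\theta\int q_{\theta_1}(y)\log\frac{q_{\theta_1}(y)}{\hat q(y;X)}\,dy$, the expectation being with respect to the true distribution of $X$. A predictive density $\hat q_a$ dominates $\hat q_b$ if $R_{KL}(\theta,\hat q_a)\le R_{KL}(\theta,\hat q_b)$ for all $\theta$ in the parameter space, with strict inequality for at least one such $\theta$. *)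

theory Defs
  imports "HOL-Probability.Probability"
begin

text \<open>All Gaussian laws are parametrised by their variance, whereas
  \<^const>\<open>normal_density\<close> takes a standard deviation.\<close>

definition gauss :: "real \<Rightarrow> real \<Rightarrow> real \<Rightarrow> real" where
  "gauss m v x = normal_density m (sqrt v) x"

text \<open>A predictive density estimator maps an observation \<open>x = (x1, x2)\<close> to a density in \<open>y\<close>.\<close>

type_synonym estimator = "real \<times> real \<Rightarrow> real \<Rightarrow> real"

definition parameter_space :: "real set \<Rightarrow> (real \<times> real) set" where
  "parameter_space A = {\<theta>. fst \<theta> - snd \<theta> \<in> A}"


subsection \<open>Nominal model, with variances \<open>v1\<close>, \<open>v2\<close>, \<open>vY\<close> of \<open>X1\<close>, \<open>X2\<close>, \<open>Y1\<close>\<close>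

definition likelihood :: "real \<Rightarrow> real \<Rightarrow> real \<times> real \<Rightarrow> real \<times> real \<Rightarrow> real" where
  "likelihood v1 v2 \<theta> x = gauss (fst \<theta>) v1 (fst x) * gauss (snd \<theta>) v2 (snd x)"

definition uniform_prior :: "real set \<Rightarrow> real \<times> real \<Rightarrow> real" where
  "uniform_prior A \<theta> = indicator A (fst \<theta> - snd \<theta>)"

definition posterior ::
  "(real \<times> real \<Rightarrow> real) \<Rightarrow> real \<Rightarrow> real \<Rightarrow> real \<times> real \<Rightarrow> real \<times> real \<Rightarrow> real" where
  "posterior \<pi> v1 v2 x \<theta> =
     likelihood v1 v2 \<theta> x * \<pi> \<theta> / (\<integral>\<theta>'. likelihood v1 v2 \<theta>' x * \<pi> \<theta>' \<partial>lborel)"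

definition q_bayes ::
  "(real \<times> real \<Rightarrow> real) \<Rightarrow> real \<Rightarrow> real \<Rightarrow> real \<Rightarrow> estimator" where
  "q_bayes \<pi> v1 v2 vY x y = (\<integral>\<theta>. gauss (fst \<theta>) vY y * posterior \<pi> v1 v2 x \<theta> \<partial>lborel)"

definition q_mre :: "real \<Rightarrow> real \<Rightarrow> estimator" where
  "q_mre v1 vY x y = gauss (fst x) (v1 + vY) y"


subsection \<open>True model, with variances \<open>w1\<close>, \<open>w2\<close>, \<open>wY\<close>: Kullback--Leibler risk and dominance\<close>

text \<open>Integral of an extended-real-valued function as the integral of its positive part minus that
  of its negative part. It is used instead of the Bochner integral, which would give a divergent
  Kullback--Leibler loss or risk the value 0. (In \<^typ>\<open>ereal\<close>, \<open>\<infinity> - \<infinity> = \<infinity>\<close>.)\<close>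

definition ext_integral :: "'a measure \<Rightarrow> ('a \<Rightarrow> ereal) \<Rightarrow> ereal" where
  "ext_integral M f =
     enn2ereal (\<integral>\<^sup>+ x. e2ennreal (f x) \<partial>M) - enn2ereal (\<integral>\<^sup>+ x. e2ennreal (- f x) \<partial>M)"

text \<open>The true density is positive, so the integrand is infinite where the predictive density
  vanishes; the case distinction is needed because of \<open>x / 0 = 0\<close> and \<open>ln 0 = 0\<close>.\<close>

definition kl_loss :: "real \<Rightarrow> real \<Rightarrow> (real \<Rightarrow> real) \<Rightarrow> ereal" where
  "kl_loss wY \<theta>1 q = ext_integral lborel
     (\<lambda>y. if q y > 0 then ereal (gauss \<theta>1 wY y * ln (gauss \<theta>1 wY y / q y)) else \<infinity>)"

definition law_X :: "real \<Rightarrow> real \<Rightarrow> real \<times> real \<Rightarrow> (real \<times> real) measure" where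
  "law_X w1 w2 \<theta> = density lborel (gauss (fst \<theta>) w1) \<Otimes>\<^sub>M density lborel (gauss (snd \<theta>) w2)"

definition kl_risk :: "real \<Rightarrow> real \<Rightarrow> real \<Rightarrow> real \<times> real \<Rightarrow> estimator \<Rightarrow> ereal" where
  "kl_risk w1 w2 wY \<theta> q = ext_integral (law_X w1 w2 \<theta>) (\<lambda>x. kl_loss wY (fst \<theta>) (q x))"

definition dominates ::
  "(real \<times> real) set \<Rightarrow> (real \<times> real \<Rightarrow> estimator \<Rightarrow> ereal) \<Rightarrow> estimator \<Rightarrow> estimator \<Rightarrow> bool" where
  "dominates \<Theta> R qa qb \<longleftrightarrow>
     (\<forall>\<theta>\<in>\<Theta>. R \<theta> qa \<le> R \<theta> qb) \<and> (\<exists>\<theta>\<in>\<Theta>. R \<theta> qa < R \<theta> qb)"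

end

theory Submission
  imports Defs
begin

text \<open>
  Completing the square in \<open>\<theta>1\<close> turns the product of the nominal densities of \<open>Y1\<close> and \<open>X1\<close> into
  the predictive density \<open>q_mre\<close> times a Gaussian in \<open>\<theta>1\<close>, centred at \<open>(1 - \<beta>) x1 + \<beta> y\<close>. The
  two integrals over the half plane \<open>\<theta>1 \<ge> \<theta>2\<close> in the definition of the posterior predictive
  density then are values of the standard normal distribution function \<open>\<Phi>\<close>, and
  \<open>q_bayes(y; x) = q_mre(y; x) \<Phi>(U) / \<Phi>(V)\<close>,
  where \<open>V\<close> is a multiple of \<open>x1 - x2\<close> and \<open>U\<close> a multiple of \<open>(1 - \<beta>) x1 + \<beta> y - x2\<close>
  (lemma \<open>q_bayes_eq\<close>). Hence the risk of \<open>q_mre\<close> exceeds that of \<open>q_bayes\<close> by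
  \<open>E log \<Phi>(U) - E log \<Phi>(V)\<close>.

  Under the true model \<open>U\<close> and \<open>V\<close> are again Gaussian, whatever the variances: their variances are
  \<open>\<sigma>U2\<close> and \<open>\<sigma>V2\<close>, and both means are positive multiples of \<open>\<theta>1 - \<theta>2\<close>, with the larger factor
  for \<open>U\<close>. The function \<open>log \<Phi>\<close> is strictly increasing and concave, so the expectation of
  \<open>log \<Phi>\<close> under a Gaussian law increases with the mean and decreases with the variance
  (lemmas \<open>E_log_Phi_strict_mono_mean\<close> and \<open>E_log_Phi_antimono_variance\<close>). For
  \<open>\<theta>1 \<ge> \<theta>2\<close> and \<open>\<sigma>U2 \<le> \<sigma>V2\<close> both effects favour \<open>U\<close>, strictly so if \<open>\<theta>1 > \<theta>2\<close>.

  All integrals are finite because \<open>\<bar>log \<Phi>(u)\<bar>\<close> grows at most quadratically; the extended-real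
  risks are therefore ordinary real integrals, which can be subtracted.
\<close>

section \<open>Gaussian laws and their linear images\<close>

definition gauss_law :: "real \<Rightarrow> real \<Rightarrow> real measure" where
  "gauss_law m v = density lborel (gauss m v)"

lemma gauss_pos: "v > 0 \<Longrightarrow> gauss m v x > 0"
  by (simp add: gauss_def normal_density_pos)

lemma gauss_nonneg: "gauss m v x \<ge> 0"
  by (simp add: gauss_def)

lemma gauss_eq: "v > 0 \<Longrightarrow> gauss m v x = exp (- (x - m)\<^sup>2 / (2 * v)) / sqrt (2 * pi * v)"
  by (simp add: gauss_def normal_density_def)

lemma gauss_commute: "gauss m v x = gauss x v m"
  by (simp add: gauss_def normal_density_def power2_commute)

lemma measurable_gauss [measurable]: "gauss m v \<in> borel_measurable borel"
  by (simp add: gauss_def[abs_def])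

lemma sets_gauss_law [simp, measurable_cong]: "sets (gauss_law m v) = sets borel"
  by (simp add: gauss_law_def)

lemma space_gauss_law [simp]: "space (gauss_law m v) = UNIV"
  by (simp add: gauss_law_def)

lemma prob_space_gauss_law: "v > 0 \<Longrightarrow> prob_space (gauss_law m v)"
  unfolding gauss_law_def gauss_def[abs_def] by (rule prob_space_normal_density) simp

lemma prob_space_gauss_law_pair:
  "v > 0 \<Longrightarrow> v' > 0 \<Longrightarrow> prob_space (gauss_law m v \<Otimes>\<^sub>M gauss_law m' v')"
  by (intro prob_space_pair prob_space_gauss_law)

lemma integral_gauss_law:
  "f \<in> borel_measurable borel \<Longrightarrow>
   (\<integral>y. f y \<partial>gauss_law m v) = (\<integral>y. gauss m v y * f y \<partial>lborel)" for f :: "real \<Rightarrow> real"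
  unfolding gauss_law_def by (rule integral_real_density) (auto simp: gauss_nonneg)

lemma integrable_gauss_law:
  "f \<in> borel_measurable borel \<Longrightarrow>
   integrable (gauss_law m v) f \<longleftrightarrow> integrable lborel (\<lambda>y. gauss m v y * f y)" for f :: "real \<Rightarrow> real"
  unfolding gauss_law_def by (rule integrable_real_density) (auto simp: gauss_nonneg)

lemma distributed_gaussI:
  assumes "distr M borel X = gauss_law m v" "X \<in> borel_measurable M"
  shows "distributed M lborel X (normal_density m (sqrt v))"
proof -
  have "distr M lborel X = distr M borel X"
    by (rule distr_cong) auto
  with assms show ?thesis
    by (simp add: distributed_def gauss_law_def gauss_def)
qed

lemma distributed_gaussD:
  assumes "distributed M lborel X (normal_density m (sqrt v))"
  shows "distr M borel X = gauss_law m v"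
proof -
  have "distr M borel X = distr M lborel X"
    by (rule distr_cong) auto
  also have "\<dots> = gauss_law m v"
    using assms by (simp only: distributed_distr_eq_density gauss_law_def gauss_def)
  finally show ?thesis .
qed

lemma distr_gauss_affine:
  assumes "v > 0" "a \<noteq> 0"
  shows "distr (gauss_law m v) borel (\<lambda>x. b + a * x) = gauss_law (b + a * m) (a\<^sup>2 * v)"
proof -
  interpret prob_space "gauss_law m v" using assms(1) by (rule prob_space_gauss_law)
  have "distr (gauss_law m v) borel (\<lambda>x. x) = gauss_law m v"
    by (simp add: distr_id2)
  then have "distributed (gauss_law m v) lborel (\<lambda>x. x) (normal_density m (sqrt v))"
    by (intro distributed_gaussI) auto
  from normal_density_affine[OF this _ assms(2), of b] assms(1)
  have "distributed (gauss_law m v) lborel (\<lambda>x. b + a * x)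
      (normal_density (b + a * m) (sqrt (a\<^sup>2 * v)))" by (simp add: real_sqrt_mult)
  then show ?thesis by (rule distributed_gaussD)
qed

lemma distr_gauss_sum:
  assumes v: "v > 0" and v': "v' > 0"
  shows "distr (gauss_law m v \<Otimes>\<^sub>M gauss_law m' v') borel (\<lambda>(x, y). x + y)
    = gauss_law (m + m') (v + v')"
proof -
  let ?P = "gauss_law m v \<Otimes>\<^sub>M gauss_law m' v'"
  interpret A: prob_space "gauss_law m v" using v by (rule prob_space_gauss_law)
  interpret B: prob_space "gauss_law m' v'" using v' by (rule prob_space_gauss_law)
  interpret P: prob_space ?P using v v' by (rule prob_space_gauss_law_pair)
  interpret pair_sigma_finite "gauss_law m v" "gauss_law m' v'" ..
  have f: "distr ?P borel fst = gauss_law m v"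
    using B.distr_pair_fst[of "gauss_law m v"] by (simp cong: distr_cong)
  have "distr ?P borel snd = distr (gauss_law m' v' \<Otimes>\<^sub>M gauss_law m v) borel fst"
    by (subst distr_pair_swap, subst distr_distr) (auto simp: comp_def case_prod_unfold)
  also have "\<dots> = gauss_law m' v'"
    using A.distr_pair_fst[of "gauss_law m' v'"] by (simp cong: distr_cong)
  finally have s: "distr ?P borel snd = gauss_law m' v'" .
  have "P.indep_var borel fst borel snd"
    unfolding P.indep_var_distribution_eq f s
  proof (intro conjI)
    show "?P = distr ?P (borel \<Otimes>\<^sub>M borel) (\<lambda>x. (fst x, snd x))"
      unfolding prod.collapse by (rule distr_id2[symmetric]) (simp cong: sets_pair_measure_cong)
  qed simp_all
  from P.add_indep_normal[OF this _ _ distributed_gaussI[OF f] distributed_gaussI[OF s]] v v'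
  have "distributed ?P lborel (\<lambda>x. fst x + snd x) (normal_density (m + m') (sqrt (v + v')))"
    by simp
  from distributed_gaussD[OF this] show ?thesis by (simp add: case_prod_unfold)
qed

lemma distr_gauss_linear:
  assumes v: "v > 0" and v': "v' > 0" and "a \<noteq> 0" "b \<noteq> 0"
  shows "distr (gauss_law m v \<Otimes>\<^sub>M gauss_law m' v') borel (\<lambda>(x, y). a * x + b * y)
    = gauss_law (a * m + b * m') (a\<^sup>2 * v + b\<^sup>2 * v')"
proof -
  have a: "distr (gauss_law m v) borel (\<lambda>x. a * x) = gauss_law (a * m) (a\<^sup>2 * v)"
    using distr_gauss_affine[of v a m 0] assms by simp
  have b: "distr (gauss_law m' v') borel (\<lambda>x. b * x) = gauss_law (b * m') (b\<^sup>2 * v')"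
    using distr_gauss_affine[of v' b m' 0] assms by simp
  have pos: "a\<^sup>2 * v > 0" "b\<^sup>2 * v' > 0" using assms by auto
  have "gauss_law (a * m + b * m') (a\<^sup>2 * v + b\<^sup>2 * v')
    = distr (gauss_law (a * m) (a\<^sup>2 * v) \<Otimes>\<^sub>M gauss_law (b * m') (b\<^sup>2 * v')) borel (\<lambda>(x, y). x + y)"
    using distr_gauss_sum[OF pos] by simp
  also have "gauss_law (a * m) (a\<^sup>2 * v) \<Otimes>\<^sub>M gauss_law (b * m') (b\<^sup>2 * v')
    = distr (gauss_law m v \<Otimes>\<^sub>M gauss_law m' v') (borel \<Otimes>\<^sub>M borel) (\<lambda>(x, y). (a * x, b * y))"
    unfolding a[symmetric] b[symmetric]
  proof (rule pair_measure_distr)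
    show "sigma_finite_measure (distr (gauss_law m' v') borel (\<lambda>x. b * x))"
      unfolding b by (intro prob_space_imp_sigma_finite prob_space_gauss_law pos)
  qed simp_all
  also have "distr \<dots> borel (\<lambda>(x, y). x + y)
    = distr (gauss_law m v \<Otimes>\<^sub>M gauss_law m' v') borel (\<lambda>(x, y). a * x + b * y)"
    by (subst distr_distr) (auto simp: comp_def case_prod_unfold)
  finally show ?thesis by simp
qed

section \<open>The standard normal distribution function\<close>

definition Phi :: "real \<Rightarrow> real" where
  "Phi u = measure (gauss_law 0 1) {..u}"

text \<open>The reflection \<open>z \<mapsto> m - sqrt v * z\<close> maps the standard Gaussian law to the given one and
  carries a lower half line to \<open>{0..}\<close>.\<close>

lemma measure_gauss_law_nonneg:
  assumes "v > 0"
  shows "measure (gauss_law m v) {0..} = Phi (m / sqrt v)"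
proof -
  have s: "- sqrt v \<noteq> 0" using assms by simp
  have "gauss_law m v = distr (gauss_law 0 1) borel (\<lambda>x. m + (- sqrt v) * x)"
    using distr_gauss_affine[of 1 "- sqrt v" 0 m] assms by simp
  moreover have "(\<lambda>x. m + (- sqrt v) * x) -` {0..} = {..m / sqrt v}"
    using assms by (auto simp: field_simps)
  ultimately show ?thesis
    by (simp add: measure_distr Phi_def)
qed

lemma Phi_le_1: "Phi u \<le> 1"
  unfolding Phi_def by (rule prob_space.prob_le_1) (rule prob_space_gauss_law, simp)

lemma Phi_nonneg: "0 \<le> Phi u"
  by (simp add: Phi_def)

lemma Phi_diff:
  assumes "a \<le> b"
  shows "Phi b - Phi a = measure (gauss_law 0 1) {a<..b}"
proof -
  interpret prob_space "gauss_law 0 1" by (rule prob_space_gauss_law) simp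
  have "{a<..b} = {..b} - {..a}" by auto
  then show ?thesis
    using assms by (simp add: Phi_def finite_measure_Diff)
qed

lemma Phi_mono: "a \<le> b \<Longrightarrow> Phi a \<le> Phi b"
  using Phi_diff[of a b] measure_nonneg[of "gauss_law 0 1" "{a<..b}"] by linarith

lemma measurable_Phi [measurable]: "Phi \<in> borel_measurable borel"
  by (rule borel_measurable_mono) (simp add: mono_def Phi_mono)

lemma Phi_diff_ge:
  assumes "a \<le> b" and "\<And>x. a < x \<Longrightarrow> x \<le> b \<Longrightarrow> c \<le> gauss 0 1 x" and "c \<ge> 0"
  shows "c * (b - a) \<le> Phi b - Phi a"
proof -
  interpret prob_space "gauss_law 0 1" by (rule prob_space_gauss_law) simp
  have "ennreal (c * (b - a)) = (\<integral>\<^sup>+x. ennreal c * indicator {a<..b} x \<partial>lborel)"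
    using assms by (simp add: nn_integral_cmult ennreal_mult)
  also have "\<dots> \<le> (\<integral>\<^sup>+x. ennreal (gauss 0 1 x) * indicator {a<..b} x \<partial>lborel)"
    using assms(2) by (intro nn_integral_mono) (auto simp: indicator_def intro!: ennreal_leI)
  also have "\<dots> = emeasure (gauss_law 0 1) {a<..b}"
    by (simp add: gauss_law_def emeasure_density)
  finally show ?thesis
    using assms(1) by (simp add: Phi_diff emeasure_eq_measure)
qed

lemma gauss_antimono_abs:
  assumes "\<bar>x\<bar> \<le> \<bar>y\<bar>"
  shows "gauss 0 1 y \<le> gauss 0 1 x"
  using assms by (simp add: gauss_eq divide_right_mono abs_le_square_iff)

text \<open>The mass of a unit interval to the left of \<open>- \<bar>u\<bar>\<close>, with the density bounded below by its
  value at the left end. A crude bound suffices: its logarithm is quadratic in \<open>u\<close>.\<close>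

lemma Phi_lower_bound: "gauss 0 1 (\<bar>u\<bar> + 1) \<le> Phi u"
proof -
  have "gauss 0 1 (\<bar>u\<bar> + 1) * (- \<bar>u\<bar> - (- \<bar>u\<bar> - 1)) \<le> Phi (- \<bar>u\<bar>) - Phi (- \<bar>u\<bar> - 1)"
    by (rule Phi_diff_ge) (auto simp: gauss_nonneg intro!: gauss_antimono_abs)
  also have "\<dots> \<le> Phi u"
    using Phi_mono[of "- \<bar>u\<bar>" u] Phi_nonneg[of "- \<bar>u\<bar> - 1"] by linarith
  finally show ?thesis by simp
qed

lemma Phi_pos: "Phi u > 0"
  using Phi_lower_bound[of u] gauss_pos[of 1 0 "\<bar>u\<bar> + 1"] by simp

lemma Phi_strict_mono:
  assumes "a < b" shows "Phi a < Phi b"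
proof -
  define c where "c = gauss 0 1 (max \<bar>a\<bar> \<bar>b\<bar>)"
  have "c * (b - a) \<le> Phi b - Phi a"
    unfolding c_def using assms
    by (intro Phi_diff_ge) (auto simp: gauss_nonneg intro!: gauss_antimono_abs)
  moreover have "c * (b - a) > 0"
    using assms by (simp add: c_def gauss_pos)
  ultimately show ?thesis by simp
qed

text \<open>The measure of a translated set, read as the measure of the set itself under a translated
  Gaussian, which has an explicit density with respect to the original one.\<close>

lemma measure_gauss_shift:
  assumes "S \<in> sets borel"
  shows "measure (gauss_law 0 1) ((\<lambda>x. x - h) -` S) = measure (gauss_law (- h) 1) S"
proof -
  have "gauss_law (- h) 1 = distr (gauss_law 0 1) borel (\<lambda>x. x - h)"
    using distr_gauss_affine[of 1 1 0 "- h"] by simp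
  then show ?thesis using assms by (simp add: measure_distr)
qed

text \<open>This is log-concavity: the ratio \<open>\<Phi>(u + h) / \<Phi>(u)\<close> decreases in \<open>u\<close>. Indeed,
  \<open>\<Phi>(u + h)\<close> is the integral over \<open>{..u}\<close> of \<open>w(x) = exp (- h x - h^2 / 2)\<close> with respect to the
  standard Gaussian law, so the ratio is the average of the decreasing function \<open>w\<close> over \<open>{..u}\<close>.
  Enlarging \<open>{..a}\<close> to \<open>{..b}\<close> adds only points where \<open>w \<le> w(a)\<close> to a set on which
  \<open>w \<ge> w(a)\<close>, which cannot raise the average.\<close>

lemma Phi_log_concave:
  assumes "a \<le> b" "0 \<le> h"
  shows "Phi (b + h) * Phi a \<le> Phi (a + h) * Phi b"
proof -
  \<comment> \<open>The weight at the boundary point \<open>a\<close>, which separates its values on the two sets.\<close>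
  define w where "w = exp (- h * a - h\<^sup>2 / 2)"
  interpret N: prob_space "gauss_law 0 1" by (rule prob_space_gauss_law) simp
  interpret S: prob_space "gauss_law (- h) 1" by (rule prob_space_gauss_law) simp
  have dens: "gauss (- h) 1 x = exp (- h * x - h\<^sup>2 / 2) * gauss 0 1 x" for x
    by (simp add: gauss_eq exp_add[symmetric] power2_eq_square field_simps flip: add_divide_distrib)
  have em: "ennreal w * emeasure (gauss_law 0 1) A = (\<integral>\<^sup>+x. ennreal (w * gauss 0 1 x) * indicator A x \<partial>lborel)"
    if [measurable]: "A \<in> sets borel" for A
    by (simp add: gauss_law_def emeasure_density ennreal_mult w_def gauss_nonneg mult.assoc
        flip: nn_integral_cmult)
  have es: "emeasure (gauss_law (- h) 1) A = (\<integral>\<^sup>+x. ennreal (gauss (- h) 1 x) * indicator A x \<partial>lborel)"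
    if [measurable]: "A \<in> sets borel" for A
    by (simp add: gauss_law_def emeasure_density)
  have "ennreal w * emeasure (gauss_law 0 1) {..a} \<le> emeasure (gauss_law (- h) 1) {..a}"
    unfolding em[OF borel_closed[OF closed_atMost]] es[OF borel_closed[OF closed_atMost]]
    using assms(2)
    by (intro nn_integral_mono)
       (auto simp: indicator_def dens w_def gauss_nonneg mult_left_mono intro!: ennreal_leI mult_right_mono)
  then have 1: "w * Phi a \<le> Phi (a + h)"
    using measure_gauss_shift[of "{..a}" h]
    by (simp add: Phi_def w_def N.emeasure_eq_measure S.emeasure_eq_measure vimage_def
        diff_le_eq atMost_def ennreal_mult[symmetric])
  have "emeasure (gauss_law (- h) 1) {a<..b} \<le> ennreal w * emeasure (gauss_law 0 1) {a<..b}"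
    unfolding em[OF greaterThanAtMost_borel] es[OF greaterThanAtMost_borel]
    using assms(2)
    by (intro nn_integral_mono)
       (auto simp: indicator_def dens w_def gauss_nonneg mult_left_mono intro!: ennreal_leI mult_right_mono)
  then have 2: "Phi (b + h) - Phi (a + h) \<le> w * (Phi b - Phi a)"
    using measure_gauss_shift[of "{a<..b}" h] assms
    by (simp add: Phi_diff w_def N.emeasure_eq_measure S.emeasure_eq_measure vimage_def
        diff_le_eq less_diff_eq greaterThanAtMost_def greaterThan_def atMost_def Int_def ennreal_mult[symmetric])
  have "Phi (b + h) * Phi a \<le> (Phi (a + h) + w * (Phi b - Phi a)) * Phi a"
    using 2 Phi_pos[of a] by (intro mult_right_mono) auto
  also have "\<dots> = Phi (a + h) * Phi a + (w * Phi a) * (Phi b - Phi a)"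
    by (simp add: algebra_simps)
  also have "\<dots> \<le> Phi (a + h) * Phi a + Phi (a + h) * (Phi b - Phi a)"
    using 1 Phi_mono[OF assms(1)] by (intro add_left_mono mult_right_mono) auto
  finally show ?thesis by (simp add: algebra_simps)
qed

section \<open>The expectation of log Phi\<close>

definition log_Phi :: "real \<Rightarrow> real" where
  "log_Phi u = ln (Phi u)"

lemma measurable_log_Phi [measurable]: "log_Phi \<in> borel_measurable borel"
  unfolding log_Phi_def[abs_def] by measurable

lemma log_Phi_mono: "a \<le> b \<Longrightarrow> log_Phi a \<le> log_Phi b"
  by (simp add: log_Phi_def Phi_pos Phi_mono)

lemma log_Phi_strict_mono: "a < b \<Longrightarrow> log_Phi a < log_Phi b"
  by (simp add: log_Phi_def Phi_pos Phi_strict_mono)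

text \<open>The increment of the concave function \<open>log \<Phi>\<close> over \<open>[m + s, m + t]\<close> is at most the one over
  the interval \<open>[m - t, m - s]\<close>, which has the same length and lies further left.\<close>

lemma log_Phi_symmetric_antimono:
  assumes "0 \<le> s" "s \<le> t"
  shows "log_Phi (m + t) + log_Phi (m - t) \<le> log_Phi (m + s) + log_Phi (m - s)"
proof -
  have "Phi (m + t) * Phi (m - t) \<le> Phi (m + s) * Phi (m - s)"
    using Phi_log_concave[of "m - t" "m + s" "t - s"] assms by (simp add: mult.commute)
  then have "ln (Phi (m + t) * Phi (m - t)) \<le> ln (Phi (m + s) * Phi (m - s))"
    by (simp add: Phi_pos)
  then show ?thesis
    by (simp add: log_Phi_def ln_mult_pos Phi_pos)
qed

lemma log_Phi_bound: "\<bar>log_Phi u\<bar> \<le> u\<^sup>2 + 1 + ln (sqrt (2 * pi))"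
proof -
  have "ln (gauss 0 1 (\<bar>u\<bar> + 1)) \<le> log_Phi u"
    unfolding log_Phi_def using Phi_lower_bound[of u] by (simp add: gauss_pos Phi_pos)
  moreover have "ln (gauss 0 1 (\<bar>u\<bar> + 1)) = - (\<bar>u\<bar> + 1)\<^sup>2 / 2 - ln (sqrt (2 * pi))"
    by (simp add: gauss_eq ln_div)
  moreover have "(\<bar>u\<bar> + 1)\<^sup>2 / 2 \<le> u\<^sup>2 + 1"
    using zero_le_power2[of "\<bar>u\<bar> - 1"] by (simp add: power2_eq_square algebra_simps)
  moreover have "log_Phi u \<le> 0"
    unfolding log_Phi_def using Phi_le_1 Phi_pos by simp
  ultimately show ?thesis by linarith
qed

lemma integrable_gauss_power:
  assumes "v > 0"
  shows "integrable (gauss_law m v) (\<lambda>x. (x - m) ^ k)"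
  using assms integrable_normal_moment[of "sqrt v" m k]
  by (simp add: integrable_gauss_law gauss_def)

lemma integrable_gauss_square:
  assumes "v > 0"
  shows "integrable (gauss_law m v) (\<lambda>x. (x - c)\<^sup>2)"
proof -
  interpret prob_space "gauss_law m v" using assms by (rule prob_space_gauss_law)
  have "integrable (gauss_law m v) (\<lambda>x. (x - m)\<^sup>2 + 2 * (m - c) * (x - m) ^ 1 + (m - c)\<^sup>2)"
    using assms by (intro Bochner_Integration.integrable_add integrable_mult_right
        integrable_gauss_power integrable_const)
  also have "(\<lambda>x. (x - m)\<^sup>2 + 2 * (m - c) * (x - m) ^ 1 + (m - c)\<^sup>2) = (\<lambda>x. (x - c)\<^sup>2)"
    by (simp add: fun_eq_iff power2_eq_square algebra_simps)
  finally show ?thesis .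
qed

lemma integrable_log_Phi:
  assumes "v > 0"
  shows "integrable (gauss_law m v) log_Phi"
proof -
  interpret prob_space "gauss_law m v" using assms by (rule prob_space_gauss_law)
  have "integrable (gauss_law m v) (\<lambda>x. (x - 0)\<^sup>2 + (1 + ln (sqrt (2 * pi))))"
    using assms by (intro Bochner_Integration.integrable_add integrable_gauss_square integrable_const)
  then show ?thesis
    by (rule Bochner_Integration.integrable_bound)
       (auto intro!: order_trans[OF log_Phi_bound])
qed

definition E_log_Phi :: "real \<Rightarrow> real \<Rightarrow> real" where
  "E_log_Phi m v = (\<integral>u. log_Phi u \<partial>gauss_law m v)"

text \<open>Gaussian laws with different parameters are compared on one probability space, where they are
  images of the same standard variable \<open>z\<close>. Both representations, with \<open>z\<close> and with \<open>- z\<close>, are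
  needed for the symmetrisation below.\<close>

lemma
  assumes "v > 0"
  shows integrable_log_Phi_affine: "integrable (gauss_law 0 1) (\<lambda>z. log_Phi (m + sqrt v * z))"
    and integrable_log_Phi_affine': "integrable (gauss_law 0 1) (\<lambda>z. log_Phi (m - sqrt v * z))"
    and E_log_Phi_affine: "E_log_Phi m v = (\<integral>z. log_Phi (m + sqrt v * z) \<partial>gauss_law 0 1)"
    and E_log_Phi_affine': "E_log_Phi m v = (\<integral>z. log_Phi (m - sqrt v * z) \<partial>gauss_law 0 1)"
proof -
  have p: "gauss_law m v = distr (gauss_law 0 1) borel (\<lambda>z. m + sqrt v * z)"
    and n: "gauss_law m v = distr (gauss_law 0 1) borel (\<lambda>z. m - sqrt v * z)"
    using distr_gauss_affine[of 1 "sqrt v" 0 m] distr_gauss_affine[of 1 "- sqrt v" 0 m] assms by auto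
  show "integrable (gauss_law 0 1) (\<lambda>z. log_Phi (m + sqrt v * z))"
    using integrable_log_Phi[OF assms, of m] unfolding p by (rule integrable_distr[rotated]) simp
  show "integrable (gauss_law 0 1) (\<lambda>z. log_Phi (m - sqrt v * z))"
    using integrable_log_Phi[OF assms, of m] unfolding n by (rule integrable_distr[rotated]) simp
  show "E_log_Phi m v = (\<integral>z. log_Phi (m + sqrt v * z) \<partial>gauss_law 0 1)"
    unfolding E_log_Phi_def p by (rule integral_distr) simp_all
  show "E_log_Phi m v = (\<integral>z. log_Phi (m - sqrt v * z) \<partial>gauss_law 0 1)"
    unfolding E_log_Phi_def n by (rule integral_distr) simp_all
qed

text \<open>Averaging the representations by \<open>z\<close> and \<open>- z\<close> replaces the integrand by
  \<open>log \<Phi>(m + s) + log \<Phi>(m - s)\<close> with \<open>s = sqrt v * \<bar>z\<bar>\<close>, which decreases pointwise as \<open>v\<close>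
  grows.\<close>

lemma E_log_Phi_antimono_variance:
  assumes "0 < v" "v \<le> v'"
  shows "E_log_Phi m v' \<le> E_log_Phi m v"
proof -
  have v': "0 < v'" using assms by simp
  have spread: "log_Phi (m + sqrt v' * z) + log_Phi (m - sqrt v' * z)
      \<le> log_Phi (m + sqrt v * z) + log_Phi (m - sqrt v * z)" for z
  proof (cases "0 \<le> z")
    case True
    then show ?thesis
      using assms by (intro log_Phi_symmetric_antimono) (auto intro!: mult_right_mono)
  next
    case False
    then show ?thesis
      using assms log_Phi_symmetric_antimono[of "sqrt v * - z" "sqrt v' * - z" m]
      by (simp add: mult_right_mono_neg mult_nonneg_nonpos)
  qed
  have "2 * E_log_Phi m v'
      = (\<integral>z. log_Phi (m + sqrt v' * z) + log_Phi (m - sqrt v' * z) \<partial>gauss_law 0 1)"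
    using v' by (simp add: integrable_log_Phi_affine integrable_log_Phi_affine'
        flip: E_log_Phi_affine E_log_Phi_affine')
  also have "\<dots> \<le> (\<integral>z. log_Phi (m + sqrt v * z) + log_Phi (m - sqrt v * z) \<partial>gauss_law 0 1)"
    using assms v' spread
    by (intro integral_mono Bochner_Integration.integrable_add
        integrable_log_Phi_affine integrable_log_Phi_affine') auto
  also have "\<dots> = 2 * E_log_Phi m v"
    using assms by (simp add: integrable_log_Phi_affine integrable_log_Phi_affine'
        flip: E_log_Phi_affine E_log_Phi_affine')
  finally show ?thesis by simp
qed

lemma E_log_Phi_mono_mean:
  assumes "0 < v" "m \<le> m'"
  shows "E_log_Phi m v \<le> E_log_Phi m' v"
  unfolding E_log_Phi_affine[OF assms(1)] using assms
  by (intro integral_mono integrable_log_Phi_affine log_Phi_mono) auto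

lemma E_log_Phi_strict_mono_mean:
  assumes "0 < v" "m < m'"
  shows "E_log_Phi m v < E_log_Phi m' v"
proof -
  interpret prob_space "gauss_law 0 1" by (rule prob_space_gauss_law) simp
  show ?thesis
    unfolding E_log_Phi_affine[OF assms(1)] using assms emeasure_space_1
    by (intro integral_less_AE_space integrable_log_Phi_affine AE_I2 log_Phi_strict_mono) auto
qed

section \<open>Extended integrals of real functions\<close>

text \<open>Neither part of an integrable function has an infinite integral, so the subtraction in
  \<^typ>\<open>ereal\<close> agrees with the one of real numbers.\<close>

lemma ext_integral_real:
  assumes "integrable M f"
  shows "ext_integral M (\<lambda>x. ereal (f x)) = ereal (\<integral>x. f x \<partial>M)"
proof -
  have fin: "(\<integral>\<^sup>+ x. ennreal (f x) \<partial>M) \<noteq> \<infinity>" "(\<integral>\<^sup>+ x. ennreal (- f x) \<partial>M) \<noteq> \<infinity>"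
    using assms by (auto simp: real_integrable_def)
  then obtain a b where ab: "(\<integral>\<^sup>+ x. ennreal (f x) \<partial>M) = ennreal a" "a \<ge> 0"
    "(\<integral>\<^sup>+ x. ennreal (- f x) \<partial>M) = ennreal b" "b \<ge> 0"
    by (metis ennreal_cases infinity_ennreal_def)
  then have "(\<integral>x. f x \<partial>M) = a - b"
    using real_lebesgue_integral_def[OF assms] by simp
  then show ?thesis
    using ab by (simp add: ext_integral_def)
qed

section \<open>The Bayes predictive density\<close>

text \<open>Read as functions of the means, the two densities make \<open>\<theta>\<close> a pair of independent Gaussian
  variables centred at \<open>m\<close> and \<open>m'\<close>; the integral is the probability that their difference is
  nonnegative.\<close>

lemma integral_truncated_gauss_pair:
  assumes v: "v > 0" and v': "v' > 0"
  shows "(\<integral>\<theta>. gauss (fst \<theta>) v m * gauss (snd \<theta>) v' m' * indicator {0..} (fst \<theta> - snd \<theta>) \<partial>lborel)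
    = Phi ((m - m') / sqrt (v + v'))"
proof -
  let ?P = "gauss_law m v \<Otimes>\<^sub>M gauss_law m' v'"
  have "?P = density (lborel \<Otimes>\<^sub>M lborel) (\<lambda>(x, y). ennreal (gauss m v x) * ennreal (gauss m' v' y))"
    unfolding gauss_law_def
    by (rule pair_measure_density)
       (auto intro!: prob_space_imp_sigma_finite prob_space_gauss_law[OF v', unfolded gauss_law_def]
        lborel.sigma_finite_measure_axioms)
  then have P: "?P = density lborel (\<lambda>\<theta>. ennreal (gauss m v (fst \<theta>) * gauss m' v' (snd \<theta>)))"
    by (simp add: lborel_prod case_prod_unfold ennreal_mult gauss_nonneg)
  have "(\<integral>\<theta>. gauss (fst \<theta>) v m * gauss (snd \<theta>) v' m' * indicator {0..} (fst \<theta> - snd \<theta>) \<partial>lborel)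
    = (\<integral>\<theta>. gauss m v (fst \<theta>) * gauss m' v' (snd \<theta>) * indicator {0..} (fst \<theta> - snd \<theta>) \<partial>lborel)"
    by (simp only: gauss_commute[of _ v m] gauss_commute[of _ v' m'])
  also have "\<dots> = (\<integral>\<theta>. indicator {0..} (fst \<theta> - snd \<theta>) \<partial>?P)"
    unfolding P by (subst integral_real_density) (auto simp: gauss_nonneg borel_prod[symmetric])
  also have "\<dots> = (\<integral>d. indicator {0..} d \<partial>distr ?P borel (\<lambda>(x, y). 1 * x + (-1) * y))"
    by (subst integral_distr) (auto simp: case_prod_unfold)
  also have "\<dots> = measure (gauss_law (m - m') (v + v')) {0..}"
    using distr_gauss_linear[OF v v', of 1 "-1" m m'] by simp
  also have "\<dots> = Phi ((m - m') / sqrt (v + v'))"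
    using v v' by (intro measure_gauss_law_nonneg) simp
  finally show ?thesis .
qed

text \<open>Completing the square in \<open>t\<close>: the joint density of an observation \<open>x\<close> and a future value
  \<open>y\<close>, as marginal of \<open>y\<close> given \<open>x\<close> times the posterior of the mean \<open>t\<close> given both.\<close>

lemma gauss_mult_conjugate:
  assumes "v1 > 0" "vY > 0" and \<beta>: "\<beta> = v1 / (v1 + vY)"
  shows "gauss t vY y * gauss t v1 x = gauss x (v1 + vY) y * gauss t (\<beta> * vY) ((1 - \<beta>) * x + \<beta> * y)"
proof -
  have b: "\<beta> * vY > 0" and bv: "(v1 + vY) * (\<beta> * vY) = v1 * vY"
    using assms(1,2) by (simp_all add: \<beta>)
  have e: "- (y - t)\<^sup>2 / (2 * vY) + - (x - t)\<^sup>2 / (2 * v1)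
    = - (y - x)\<^sup>2 / (2 * (v1 + vY)) + - ((1 - \<beta>) * x + \<beta> * y - t)\<^sup>2 / (2 * (\<beta> * vY))"
  proof -
    have "1 - \<beta> = vY / (v1 + vY)"
      using assms by (simp add: field_simps)
    then have "(1 - \<beta>) * x + \<beta> * y - t = (vY * (x - t) + v1 * (y - t)) / (v1 + vY)"
      using assms(1,2) by (simp add: \<beta> divide_simps) (simp add: algebra_simps)
    then have "- ((1 - \<beta>) * x + \<beta> * y - t)\<^sup>2 / (2 * (\<beta> * vY))
      = - (vY * (x - t) + v1 * (y - t))\<^sup>2 / (2 * ((v1 + vY) * (v1 * vY)))"
      using assms by (simp add: power_divide power2_eq_square)
    moreover define p q where "p = x - t" and "q = y - t"
    moreover have "- q\<^sup>2 / (2 * vY) + - p\<^sup>2 / (2 * v1)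
      = - (q - p)\<^sup>2 / (2 * (v1 + vY)) + - (vY * p + v1 * q)\<^sup>2 / (2 * ((v1 + vY) * (v1 * vY)))"
      using assms by (simp add: divide_simps add_eq_0_iff) (simp add: power2_eq_square algebra_simps)
    ultimately show ?thesis by simp
  qed
  have s: "sqrt (2 * pi * vY) * sqrt (2 * pi * v1) = sqrt (2 * pi * (v1 + vY)) * sqrt (2 * pi * (\<beta> * vY))"
    unfolding real_sqrt_mult[symmetric]
    using arg_cong[OF bv, of "\<lambda>u. sqrt (4 * pi * pi * u)"] by (auto simp: mult_ac)
  have "gauss t vY y * gauss t v1 x
      = exp (- (y - t)\<^sup>2 / (2 * vY) + - (x - t)\<^sup>2 / (2 * v1)) / (sqrt (2 * pi * vY) * sqrt (2 * pi * v1))"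
    using assms(1,2) by (simp only: gauss_eq exp_add times_divide_times_eq)
  also have "\<dots> = exp (- (y - x)\<^sup>2 / (2 * (v1 + vY)) + - ((1 - \<beta>) * x + \<beta> * y - t)\<^sup>2 / (2 * (\<beta> * vY)))
      / (sqrt (2 * pi * (v1 + vY)) * sqrt (2 * pi * (\<beta> * vY)))"
    unfolding e s ..
  also have "\<dots> = gauss x (v1 + vY) y * gauss t (\<beta> * vY) ((1 - \<beta>) * x + \<beta> * y)"
    using assms(1,2) b by (simp only: gauss_eq exp_add times_divide_times_eq add_pos_pos)
  finally show ?thesis .
qed

text \<open>The arguments of \<open>\<Phi>\<close> in the normalising constant and in the numerator of the Bayes predictive
  density.\<close>

definition V_stat :: "real \<Rightarrow> real \<Rightarrow> real \<times> real \<Rightarrow> real" where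
  "V_stat v1 v2 x = (fst x - snd x) / sqrt (v1 + v2)"

definition U_stat :: "real \<Rightarrow> real \<Rightarrow> real \<Rightarrow> real \<times> real \<Rightarrow> real \<Rightarrow> real" where
  "U_stat v1 v2 vY x y =
     (let \<beta> = v1 / (v1 + vY) in ((1 - \<beta>) * fst x + \<beta> * y - snd x) / sqrt (v2 + \<beta> * vY))"

lemma q_mre_pos: "v1 > 0 \<Longrightarrow> vY > 0 \<Longrightarrow> q_mre v1 vY x y > 0"
  by (simp add: q_mre_def gauss_pos)

text \<open>Both the normalising constant of the posterior and the predictive integral are truncated
  integrals of a pair of Gaussian densities; in the latter the pair arises after the factor
  \<open>q_mre\<close> is split off by conjugacy.\<close>

lemma q_bayes_eq:
  assumes v: "v1 > 0" "v2 > 0" "vY > 0"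
  shows "q_bayes (uniform_prior {0..}) v1 v2 vY x y
    = q_mre v1 vY x y * Phi (U_stat v1 v2 vY x y) / Phi (V_stat v1 v2 x)"
proof -
  define \<beta> where "\<beta> = v1 / (v1 + vY)"
  define Z where "Z = (\<integral>\<theta>. likelihood v1 v2 \<theta> x * uniform_prior {0..} \<theta> \<partial>lborel)"
  define m where "m = (1 - \<beta>) * fst x + \<beta> * y"
  have Z: "Z = Phi (V_stat v1 v2 x)"
    unfolding Z_def likelihood_def uniform_prior_def V_stat_def
    using v(1,2) by (rule integral_truncated_gauss_pair)
  have b: "\<beta> * vY > 0" using v by (simp add: \<beta>_def)
  have "gauss (fst \<theta>) vY y * posterior (uniform_prior {0..}) v1 v2 x \<theta>
    = q_mre v1 vY x y / Z *
      (gauss (fst \<theta>) (\<beta> * vY) m * gauss (snd \<theta>) v2 (snd x) * indicator {0..} (fst \<theta> - snd \<theta>))" for \<theta>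
    using gauss_mult_conjugate[OF v(1,3) \<beta>_def, of "fst \<theta>" y "fst x"]
    unfolding posterior_def Z_def[symmetric]
    by (simp add: likelihood_def uniform_prior_def q_mre_def m_def)
  then have "q_bayes (uniform_prior {0..}) v1 v2 vY x y
    = q_mre v1 vY x y / Z * Phi ((m - snd x) / sqrt (\<beta> * vY + v2))"
    by (simp add: q_bayes_def integral_truncated_gauss_pair[OF b v(2)])
  then show ?thesis
    by (simp add: Z m_def U_stat_def Let_def add.commute flip: \<beta>_def)
qed

section \<open>Kullback--Leibler loss and risk\<close>

lemma kl_loss_eq:
  assumes q: "\<And>y. q y > 0" and [measurable]: "q \<in> borel_measurable borel"
    and i: "integrable (gauss_law t w) (\<lambda>y. ln (gauss t w y / q y))"
  shows "kl_loss w t q = ereal (\<integral>y. ln (gauss t w y / q y) \<partial>gauss_law t w)"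
proof -
  have "kl_loss w t q = ext_integral lborel (\<lambda>y. ereal (gauss t w y * ln (gauss t w y / q y)))"
    by (simp add: kl_loss_def q)
  also have "\<dots> = ereal (\<integral>y. gauss t w y * ln (gauss t w y / q y) \<partial>lborel)"
    using i by (intro ext_integral_real) (simp add: integrable_gauss_law)
  finally show ?thesis by (simp add: integral_gauss_law)
qed

lemma ln_gauss_ratio:
  assumes "v > 0" "w > 0"
  shows "ln (gauss t w y / gauss x v y)
    = ln (sqrt (2 * pi * v) / sqrt (2 * pi * w)) + (y - x)\<^sup>2 / (2 * v) - (y - t)\<^sup>2 / (2 * w)"
  using assms by (simp add: gauss_eq ln_div ln_mult_pos)

lemma integrable_ln_gauss_ratio:
  assumes "v > 0" "w > 0"
  shows "integrable (gauss_law t w) (\<lambda>y. ln (gauss t w y / gauss x v y))"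
proof -
  interpret prob_space "gauss_law t w" using assms(2) by (rule prob_space_gauss_law)
  show ?thesis
    unfolding ln_gauss_ratio[OF assms] using assms
    by (intro Bochner_Integration.integrable_add Bochner_Integration.integrable_diff
        integrable_divide integrable_gauss_square integrable_const)
qed

text \<open>The log-ratio is quadratic in the pair \<open>(x, y)\<close>, hence jointly integrable, and Fubini's
  theorem gives integrability of its partial integral.\<close>

lemma integrable_expected_ln_gauss_ratio:
  assumes "v > 0" "w > 0" "w1 > 0"
  shows "integrable (gauss_law t1 w1) (\<lambda>x. \<integral>y. ln (gauss t w y / gauss x v y) \<partial>gauss_law t w)"
proof -
  interpret A: prob_space "gauss_law t1 w1" using assms(3) by (rule prob_space_gauss_law)
  interpret B: prob_space "gauss_law t w" using assms(2) by (rule prob_space_gauss_law)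
  interpret pair_sigma_finite "gauss_law t1 w1" "gauss_law t w" ..
  let ?P = "gauss_law t1 w1 \<Otimes>\<^sub>M gauss_law t w"
  interpret P: prob_space ?P using assms by (intro prob_space_gauss_law_pair)
  have lin: "integrable ?P (\<lambda>p. (a * fst p + b * snd p - c)\<^sup>2)" if "a \<noteq> 0" "b \<noteq> 0" for a b c
  proof -
    have "integrable (distr ?P borel (\<lambda>(x, y). a * x + b * y)) (\<lambda>u. (u - c)\<^sup>2)"
      unfolding distr_gauss_linear[OF assms(3,2) that] using assms that
      by (intro integrable_gauss_square) (simp add: add_pos_pos)
    from integrable_distr[OF _ this] show ?thesis by (simp add: case_prod_unfold)
  qed
  have snd: "integrable ?P (\<lambda>p. (snd p - t)\<^sup>2)"
  proof -
    have "integrable (distr (gauss_law t w \<Otimes>\<^sub>M gauss_law t1 w1) (gauss_law t w) fst) (\<lambda>u. (u - t)\<^sup>2)"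
      unfolding A.distr_pair_fst using assms(2) by (rule integrable_gauss_square)
    from integrable_distr[OF _ this]
    have "integrable (gauss_law t w \<Otimes>\<^sub>M gauss_law t1 w1) (\<lambda>p. (fst p - t)\<^sup>2)" by simp
    then show ?thesis
      by (subst integrable_product_swap_iff[symmetric]) (simp add: case_prod_unfold)
  qed
  have "integrable ?P (\<lambda>p. ln (gauss t w (snd p) / gauss (fst p) v (snd p)))"
    unfolding ln_gauss_ratio[OF assms(1,2)] using lin[of "-1" 1 0] snd
    by (intro Bochner_Integration.integrable_add Bochner_Integration.integrable_diff
        integrable_divide P.integrable_const) simp_all
  from integrable_fst'[OF this] show ?thesis by simp
qed

lemma law_X_eq: "law_X w1 w2 \<theta> = gauss_law (fst \<theta>) w1 \<Otimes>\<^sub>M gauss_law (snd \<theta>) w2"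
  by (simp add: law_X_def gauss_law_def)

lemma sets_law_X [simp, measurable_cong]: "sets (law_X w1 w2 \<theta>) = sets (borel \<Otimes>\<^sub>M borel)"
  unfolding law_X_eq by (rule sets_pair_measure_cong) simp_all

lemma prob_space_law_X: "w1 > 0 \<Longrightarrow> w2 > 0 \<Longrightarrow> prob_space (law_X w1 w2 \<theta>)"
  unfolding law_X_eq by (rule prob_space_gauss_law_pair)

lemma measurable_V_stat [measurable]: "V_stat v1 v2 \<in> borel_measurable (borel \<Otimes>\<^sub>M borel)"
  unfolding V_stat_def[abs_def] by measurable

lemma measurable_U_stat [measurable]:
  "(\<lambda>p. U_stat v1 v2 vY (fst p) (snd p)) \<in> borel_measurable ((borel \<Otimes>\<^sub>M borel) \<Otimes>\<^sub>M borel)"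
  unfolding U_stat_def[abs_def] Let_def by measurable

lemma measurable_U_stat' [measurable]: "U_stat v1 v2 vY x \<in> borel_measurable borel"
  unfolding U_stat_def[abs_def] Let_def by measurable

lemma distr_V_stat:
  assumes "v1 > 0" "v2 > 0" "w1 > 0" "w2 > 0"
  shows "distr (law_X w1 w2 \<theta>) borel (V_stat v1 v2)
    = gauss_law ((fst \<theta> - snd \<theta>) / sqrt (v1 + v2)) ((w1 + w2) / (v1 + v2))"
proof -
  define c where "c = 1 / sqrt (v1 + v2)"
  have "c \<noteq> 0" and c2: "c\<^sup>2 = 1 / (v1 + v2)"
    using assms by (auto simp: c_def power_divide)
  have "V_stat v1 v2 = (\<lambda>(x, y). c * x + (- c) * y)"
    by (simp add: fun_eq_iff V_stat_def c_def flip: diff_divide_distrib)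
  moreover have "gauss_law (c * fst \<theta> + (- c) * snd \<theta>) (c\<^sup>2 * w1 + (- c)\<^sup>2 * w2)
      = gauss_law ((fst \<theta> - snd \<theta>) / sqrt (v1 + v2)) ((w1 + w2) / (v1 + v2))"
    unfolding power2_minus c2 by (simp add: c_def diff_divide_distrib add_divide_distrib)
  ultimately show ?thesis
    using distr_gauss_linear[of w1 w2 c "- c" "fst \<theta>" "snd \<theta>"] assms \<open>c \<noteq> 0\<close>
    by (simp only: law_X_eq) simp
qed

text \<open>Here \<open>X\<close> and \<open>Y1\<close> are independent and \<open>Y1\<close> has the same mean as \<open>X1\<close>, so that the weights
  \<open>1 - \<beta>\<close> and \<open>\<beta>\<close> recombine to the mean \<open>\<theta>1 - \<theta>2\<close> up to scaling. The linear combination is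
  formed in two steps: the part depending on \<open>X\<close>, then the contribution of \<open>Y1\<close>.\<close>

lemma distr_U_stat:
  assumes v: "v1 > 0" "v2 > 0" "vY > 0" and w: "w1 > 0" "w2 > 0" "wY > 0"
    and \<beta>: "\<beta> = v1 / (v1 + vY)"
  shows "distr (law_X w1 w2 \<theta> \<Otimes>\<^sub>M gauss_law (fst \<theta>) wY) borel (\<lambda>p. U_stat v1 v2 vY (fst p) (snd p))
    = gauss_law ((fst \<theta> - snd \<theta>) / sqrt (v2 + \<beta> * vY))
        ((w2 + (1 - \<beta>)\<^sup>2 * w1 + \<beta>\<^sup>2 * wY) / (v2 + \<beta> * vY))"
proof -
  define c where "c = 1 / sqrt (v2 + \<beta> * vY)"
  define b where "b = (1 - \<beta>) * c"
  have \<beta>0: "0 < \<beta>" "\<beta> < 1" using v by (auto simp: \<beta>)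
  then have pos: "v2 + \<beta> * vY > 0" using v by (simp add: add_pos_pos)
  have c0: "c \<noteq> 0" and c2: "c\<^sup>2 = 1 / (v2 + \<beta> * vY)"
    using pos by (auto simp: c_def power_divide)
  have b0: "b \<noteq> 0" using c0 \<beta>0 by (simp add: b_def)
  have cb0: "c * \<beta> \<noteq> 0" using c0 \<beta>0 by simp
  define m s where "m = b * fst \<theta> + (- c) * snd \<theta>" and "s = b\<^sup>2 * w1 + (- c)\<^sup>2 * w2"
  have s0: "s > 0" using w b0 by (simp add: s_def add_pos_nonneg)
  have "distr (law_X w1 w2 \<theta>) borel (\<lambda>(x, y). b * x + (- c) * y) = gauss_law m s"
    unfolding law_X_eq m_def s_def using w b0 c0 by (intro distr_gauss_linear) auto
  moreover have "distr (gauss_law (fst \<theta>) wY) borel (\<lambda>y. y) = gauss_law (fst \<theta>) wY"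
    by (rule distr_id2) simp
  moreover have "distr (law_X w1 w2 \<theta>) borel (\<lambda>(x, y). b * x + (- c) * y)
      \<Otimes>\<^sub>M distr (gauss_law (fst \<theta>) wY) borel (\<lambda>y. y)
    = distr (law_X w1 w2 \<theta> \<Otimes>\<^sub>M gauss_law (fst \<theta>) wY) (borel \<Otimes>\<^sub>M borel)
        (\<lambda>(x, y). (case x of (x1, x2) \<Rightarrow> b * x1 + (- c) * x2, y))"
  proof (rule pair_measure_distr)
    show "sigma_finite_measure (distr (gauss_law (fst \<theta>) wY) borel (\<lambda>y. y))"
      unfolding \<open>distr (gauss_law (fst \<theta>) wY) borel (\<lambda>y. y) = _\<close>
      by (intro prob_space_imp_sigma_finite prob_space_gauss_law w)
  qed simp_all
  ultimately have "gauss_law m s \<Otimes>\<^sub>M gauss_law (fst \<theta>) wY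
    = distr (law_X w1 w2 \<theta> \<Otimes>\<^sub>M gauss_law (fst \<theta>) wY) (borel \<Otimes>\<^sub>M borel)
        (\<lambda>(x, y). (case x of (x1, x2) \<Rightarrow> b * x1 + (- c) * x2, y))"
    by simp
  moreover have "distr (gauss_law m s \<Otimes>\<^sub>M gauss_law (fst \<theta>) wY) borel (\<lambda>(x, y). 1 * x + c * \<beta> * y)
    = gauss_law (1 * m + c * \<beta> * fst \<theta>) (1\<^sup>2 * s + (c * \<beta>)\<^sup>2 * wY)"
    using s0 w cb0 by (intro distr_gauss_linear) auto
  ultimately have "gauss_law (m + c * \<beta> * fst \<theta>) (s + (c * \<beta>)\<^sup>2 * wY)
    = distr (law_X w1 w2 \<theta> \<Otimes>\<^sub>M gauss_law (fst \<theta>) wY) borel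
        ((\<lambda>(x, y). x + c * \<beta> * y) \<circ> (\<lambda>(x, y). (case x of (x1, x2) \<Rightarrow> b * x1 + (- c) * x2, y)))"
    by (simp add: distr_distr)
  also have "(\<lambda>(x, y). x + c * \<beta> * y) \<circ> (\<lambda>(x, y). (case x of (x1, x2) \<Rightarrow> b * x1 + (- c) * x2, y))
    = (\<lambda>p. U_stat v1 v2 vY (fst p) (snd p))"
    by (simp add: fun_eq_iff U_stat_def Let_def c_def b_def mult.commute
        flip: \<beta> add_divide_distrib diff_divide_distrib)
  also have "m + c * \<beta> * fst \<theta> = (fst \<theta> - snd \<theta>) / sqrt (v2 + \<beta> * vY)"
    by (simp add: m_def b_def c_def flip: add_divide_distrib diff_divide_distrib)
       (simp add: algebra_simps)
  also have "s + (c * \<beta>)\<^sup>2 * wY = (w2 + (1 - \<beta>)\<^sup>2 * w1 + \<beta>\<^sup>2 * wY) / (v2 + \<beta> * vY)"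
    by (simp add: s_def b_def power_mult_distrib c2 add_divide_distrib mult.commute)
  finally show ?thesis by simp
qed

text \<open>Fubini's theorem would give this for almost every \<open>x\<close> only, whereas the loss is evaluated at
  every \<open>x\<close>. For fixed \<open>x\<close>, however, \<open>U\<close> is affine in \<open>y\<close> and thus Gaussian.\<close>

lemma integrable_log_Phi_U_stat_section:
  assumes v: "v1 > 0" "v2 > 0" "vY > 0" and "wY > 0"
  shows "integrable (gauss_law t wY) (\<lambda>y. log_Phi (U_stat v1 v2 vY x y))"
proof -
  define \<beta> where "\<beta> = v1 / (v1 + vY)"
  define a b where "a = ((1 - \<beta>) * fst x - snd x) / sqrt (v2 + \<beta> * vY)" and "b = \<beta> / sqrt (v2 + \<beta> * vY)"
  have "\<beta> > 0" using v by (simp add: \<beta>_def)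
  then have "v2 + \<beta> * vY > 0" using v by (simp add: add_pos_pos)
  with \<open>\<beta> > 0\<close> have b: "b \<noteq> 0" by (simp add: b_def)
  have U: "U_stat v1 v2 vY x y = a + b * y" for y
    by (simp add: U_stat_def Let_def a_def b_def flip: \<beta>_def add_divide_distrib)
  have "integrable (distr (gauss_law t wY) borel (\<lambda>y. a + b * y)) log_Phi"
    unfolding distr_gauss_affine[OF assms(4) b] using assms(4) b
    by (intro integrable_log_Phi) simp
  from integrable_distr[OF _ this] show ?thesis by (simp add: U)
qed

text \<open>At each \<open>x\<close> the losses differ by \<open>log \<Phi>(V)\<close> minus the conditional expectation of
  \<open>log \<Phi>(U)\<close>; integrating over \<open>x\<close> leaves expectations under the Gaussian laws of \<open>V\<close> and
  \<open>U\<close>. That \<open>R\<close> is a real number lets the two risks be compared by subtraction.\<close>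

lemma kl_risk_mre_and_bayes:
  assumes v: "v1 > 0" "v2 > 0" "vY > 0" and w: "w1 > 0" "w2 > 0" "wY > 0"
    and \<beta>: "\<beta> = v1 / (v1 + vY)"
  obtains R where
    "kl_risk w1 w2 wY \<theta> (q_mre v1 vY) = ereal R"
    "kl_risk w1 w2 wY \<theta> (q_bayes (uniform_prior {0..}) v1 v2 vY) = ereal (R
       + E_log_Phi ((fst \<theta> - snd \<theta>) / sqrt (v1 + v2)) ((w1 + w2) / (v1 + v2))
       - E_log_Phi ((fst \<theta> - snd \<theta>) / sqrt (v2 + \<beta> * vY))
           ((w2 + (1 - \<beta>)\<^sup>2 * w1 + \<beta>\<^sup>2 * wY) / (v2 + \<beta> * vY)))"
proof -
  define t where "t = fst \<theta>"
  let ?N = "gauss_law t wY" and ?X = "law_X w1 w2 \<theta>"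
  let ?U = "U_stat v1 v2 vY" and ?V = "V_stat v1 v2"
  let ?qb = "q_bayes (uniform_prior {0..}) v1 v2 vY" and ?qm = "q_mre v1 vY"
  interpret N: prob_space ?N using w(3) by (rule prob_space_gauss_law)
  interpret X1: prob_space "gauss_law (fst \<theta>) w1" using w(1) by (rule prob_space_gauss_law)
  interpret X2: prob_space "gauss_law (snd \<theta>) w2" using w(2) by (rule prob_space_gauss_law)
  interpret X: prob_space ?X using w(1,2) by (rule prob_space_law_X)
  interpret XN: pair_sigma_finite ?X ?N ..
  have s: "v1 + vY > 0" using v by simp
  have b: "v2 + \<beta> * vY > 0" using v by (simp add: \<beta> add_pos_pos)
  define D where "D x1 = (\<integral>y. ln (gauss t wY y / gauss x1 (v1 + vY) y) \<partial>?N)" for x1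
  define H where "H x = (\<integral>y. log_Phi (?U x y) \<partial>?N)" for x
  have loss_mre: "kl_loss wY t (?qm x) = ereal (D (fst x))" for x
    using integrable_ln_gauss_ratio[OF s w(3), of t "fst x"] v
    by (subst kl_loss_eq) (auto simp: q_mre_def[abs_def] gauss_pos D_def)
  have loss_bayes: "kl_loss wY t (?qb x) = ereal (D (fst x) + log_Phi (?V x) - H x)" for x
  proof -
    have qb: "?qb x = (\<lambda>y. gauss (fst x) (v1 + vY) y * Phi (?U x y) / Phi (?V x))"
      using v by (simp add: fun_eq_iff q_bayes_eq q_mre_def)
    have ln: "ln (gauss t wY y / ?qb x y)
        = ln (gauss t wY y / gauss (fst x) (v1 + vY) y) + log_Phi (?V x) - log_Phi (?U x y)" for y
      using gauss_pos[OF w(3), of t y] gauss_pos[OF s, of "fst x" y] Phi_pos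
      by (simp add: qb log_Phi_def ln_div ln_mult_pos less_imp_neq[symmetric])
    have i: "integrable ?N (\<lambda>y. ln (gauss t wY y / gauss (fst x) (v1 + vY) y))"
      using s w(3) by (rule integrable_ln_gauss_ratio)
    have iU: "integrable ?N (\<lambda>y. log_Phi (?U x y))"
      using v w(3) by (rule integrable_log_Phi_U_stat_section)
    have "kl_loss wY t (?qb x) = ereal (\<integral>y. ln (gauss t wY y / ?qb x y) \<partial>?N)"
    proof (rule kl_loss_eq)
      show "?qb x y > 0" for y using s Phi_pos by (simp add: qb gauss_pos)
      show "?qb x \<in> borel_measurable borel" unfolding qb by measurable
      show "integrable ?N (\<lambda>y. ln (gauss t wY y / ?qb x y))"
        unfolding ln using i iU by simp
    qed
    also have "(\<integral>y. ln (gauss t wY y / ?qb x y) \<partial>?N) = D (fst x) + log_Phi (?V x) - H x"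
      unfolding ln using i iU N.prob_space by (simp add: D_def H_def)
    finally show ?thesis .
  qed
  have "integrable (distr ?X (gauss_law (fst \<theta>) w1) fst) D"
    unfolding law_X_eq X2.distr_pair_fst D_def[abs_def]
    using s w by (intro integrable_expected_ln_gauss_ratio)
  from integrable_distr[OF _ this] have iD: "integrable ?X (\<lambda>x. D (fst x))"
    by (simp add: law_X_eq)
  have iV: "integrable ?X (\<lambda>x. log_Phi (?V x))"
  proof -
    have "integrable (distr ?X borel ?V) log_Phi"
      unfolding distr_V_stat[OF v(1,2) w(1,2)] using v w by (intro integrable_log_Phi) simp
    from integrable_distr[OF _ this] show ?thesis by simp
  qed
  have EV: "(\<integral>x. log_Phi (?V x) \<partial>?X)
      = E_log_Phi ((fst \<theta> - snd \<theta>) / sqrt (v1 + v2)) ((w1 + w2) / (v1 + v2))"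
    unfolding E_log_Phi_def distr_V_stat[OF v(1,2) w(1,2), symmetric]
    by (rule integral_distr[symmetric]) simp_all
  note dU = distr_U_stat[OF v w \<beta>, of \<theta>, folded t_def]
  have iU: "integrable (?X \<Otimes>\<^sub>M ?N) (\<lambda>p. log_Phi (?U (fst p) (snd p)))"
  proof -
    have "w2 + (1 - \<beta>)\<^sup>2 * w1 + \<beta>\<^sup>2 * wY > 0"
      using w by (intro add_pos_nonneg) auto
    then have "integrable (distr (?X \<Otimes>\<^sub>M ?N) borel (\<lambda>p. ?U (fst p) (snd p))) log_Phi"
      unfolding dU using b by (intro integrable_log_Phi) simp
    from integrable_distr[OF _ this] show ?thesis by simp
  qed
  have iH: "integrable ?X H"
    using XN.integrable_fst'[OF iU] by (simp add: H_def[abs_def])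
  have "(\<integral>x. H x \<partial>?X) = (\<integral>p. log_Phi (?U (fst p) (snd p)) \<partial>(?X \<Otimes>\<^sub>M ?N))"
    using XN.integral_fst'[OF iU] by (simp add: H_def)
  also have "\<dots> = E_log_Phi ((t - snd \<theta>) / sqrt (v2 + \<beta> * vY))
      ((w2 + (1 - \<beta>)\<^sup>2 * w1 + \<beta>\<^sup>2 * wY) / (v2 + \<beta> * vY))"
    unfolding E_log_Phi_def dU[symmetric] by (rule integral_distr[symmetric]) simp_all
  finally have EH: "(\<integral>x. H x \<partial>?X) = \<dots>" .
  show ?thesis
  proof (rule that)
    show "kl_risk w1 w2 wY \<theta> ?qm = ereal (\<integral>x. D (fst x) \<partial>?X)"
      unfolding kl_risk_def t_def[symmetric] loss_mre using iD by (rule ext_integral_real)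
    have "kl_risk w1 w2 wY \<theta> ?qb = ereal (\<integral>x. D (fst x) + log_Phi (?V x) - H x \<partial>?X)"
      unfolding kl_risk_def t_def[symmetric] loss_bayes
      using iD iV iH by (intro ext_integral_real) simp
    also have "(\<integral>x. D (fst x) + log_Phi (?V x) - H x \<partial>?X)
        = (\<integral>x. D (fst x) \<partial>?X) + (\<integral>x. log_Phi (?V x) \<partial>?X) - (\<integral>x. H x \<partial>?X)"
      using iD iV iH by simp
    finally show "kl_risk w1 w2 wY \<theta> ?qb = ereal ((\<integral>x. D (fst x) \<partial>?X)
       + E_log_Phi ((fst \<theta> - snd \<theta>) / sqrt (v1 + v2)) ((w1 + w2) / (v1 + v2))
       - E_log_Phi ((fst \<theta> - snd \<theta>) / sqrt (v2 + \<beta> * vY))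
           ((w2 + (1 - \<beta>)\<^sup>2 * w1 + \<beta>\<^sup>2 * wY) / (v2 + \<beta> * vY)))"
      by (simp add: EV EH t_def)
  qed
qed

section \<open>Dominance\<close>

text \<open>The factor \<open>kU\<close> of \<open>\<theta>1 - \<theta>2\<close> in the mean of \<open>U\<close> exceeds the factor \<open>kV\<close> for \<open>V\<close> because
  \<open>\<beta> vY < v1\<close>: combining \<open>X1\<close> with \<open>Y1\<close> gives a nominally more precise estimate of \<open>\<theta>1\<close> than
  \<open>X1\<close> alone. Strictness at \<open>\<theta> = (1, 0)\<close> comes from the means, which differ there even if the
  variances agree.\<close>

lemma q_bayes_dominates_q_mre:
  assumes v: "v1 > 0" "v2 > 0" "vY > 0" and w: "w1 > 0" "w2 > 0" "wY > 0"
    and \<beta>: "\<beta> = v1 / (v1 + vY)"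
    and le: "(w2 + (1 - \<beta>)\<^sup>2 * w1 + \<beta>\<^sup>2 * wY) / (v2 + \<beta> * vY) \<le> (w1 + w2) / (v1 + v2)"
  shows "dominates (parameter_space {0..}) (kl_risk w1 w2 wY)
    (q_bayes (uniform_prior {0..}) v1 v2 vY) (q_mre v1 vY)"
proof -
  define sU sV where "sU = (w2 + (1 - \<beta>)\<^sup>2 * w1 + \<beta>\<^sup>2 * wY) / (v2 + \<beta> * vY)"
    and "sV = (w1 + w2) / (v1 + v2)"
  define kU kV where "kU = 1 / sqrt (v2 + \<beta> * vY)" and "kV = 1 / sqrt (v1 + v2)"
  have b: "v2 + \<beta> * vY > 0" using v by (simp add: \<beta> add_pos_pos)
  have "w2 + (1 - \<beta>)\<^sup>2 * w1 + \<beta>\<^sup>2 * wY > 0"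
    using w by (intro add_pos_nonneg) auto
  with b have sU: "sU > 0" by (simp add: sU_def)
  have sUV: "sU \<le> sV" using le by (simp add: sU_def sV_def)
  have "\<beta> * vY < v1" using v by (simp add: \<beta> field_simps)
  then have k: "kV < kU" using b by (simp add: kU_def kV_def frac_less2)
  have gain: "E_log_Phi (kV * \<delta>) sV \<le> E_log_Phi (kV * \<delta>) sU" for \<delta>
    using sU sUV by (rule E_log_Phi_antimono_variance)
  have diff: "\<exists>R. kl_risk w1 w2 wY \<theta> (q_mre v1 vY) = ereal R \<and>
      kl_risk w1 w2 wY \<theta> (q_bayes (uniform_prior {0..}) v1 v2 vY)
        = ereal (R + E_log_Phi (kV * (fst \<theta> - snd \<theta>)) sV - E_log_Phi (kU * (fst \<theta> - snd \<theta>)) sU)" for \<theta>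
  proof -
    obtain R where "kl_risk w1 w2 wY \<theta> (q_mre v1 vY) = ereal R"
      "kl_risk w1 w2 wY \<theta> (q_bayes (uniform_prior {0..}) v1 v2 vY) = ereal (R
         + E_log_Phi ((fst \<theta> - snd \<theta>) / sqrt (v1 + v2)) ((w1 + w2) / (v1 + v2))
         - E_log_Phi ((fst \<theta> - snd \<theta>) / sqrt (v2 + \<beta> * vY))
             ((w2 + (1 - \<beta>)\<^sup>2 * w1 + \<beta>\<^sup>2 * wY) / (v2 + \<beta> * vY)))"
      by (rule kl_risk_mre_and_bayes[OF v w \<beta>])
    then show ?thesis by (simp add: sU_def sV_def kU_def kV_def)
  qed
  show ?thesis
    unfolding dominates_def
  proof (intro conjI ballI bexI)
    fix \<theta> :: "real \<times> real"
    assume "\<theta> \<in> parameter_space {0..}"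
    then have "0 \<le> fst \<theta> - snd \<theta>" by (simp add: parameter_space_def)
    then have "E_log_Phi (kV * (fst \<theta> - snd \<theta>)) sU \<le> E_log_Phi (kU * (fst \<theta> - snd \<theta>)) sU"
      using k by (intro E_log_Phi_mono_mean[OF sU] mult_right_mono) auto
    with gain[of "fst \<theta> - snd \<theta>"] diff[of \<theta>]
    show "kl_risk w1 w2 wY \<theta> (q_bayes (uniform_prior {0..}) v1 v2 vY)
        \<le> kl_risk w1 w2 wY \<theta> (q_mre v1 vY)"
      by auto
  next
    have "E_log_Phi (kV * 1) sU < E_log_Phi (kU * 1) sU"
      using k by (intro E_log_Phi_strict_mono_mean[OF sU]) simp
    with gain[of 1] diff[of "(1, 0)"]
    show "kl_risk w1 w2 wY (1, 0) (q_bayes (uniform_prior {0..}) v1 v2 vY)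
        < kl_risk w1 w2 wY (1, 0) (q_mre v1 vY)"
      by auto
    show "(1, 0) \<in> parameter_space {0..}" by (simp add: parameter_space_def)
  qed
qed

text \<open>The weights are inversely proportional to the variances, so the combination of two independent estimates of a common mean has minimal
  variance, namely \<open>v1 vY / (v1 + vY)\<close>.\<close>

lemma shrunk_variance_eq:
  fixes v1 vY :: real
  assumes "v1 > 0" "vY > 0" and \<beta>: "\<beta> = v1 / (v1 + vY)"
  shows "(1 - \<beta>)\<^sup>2 * v1 + \<beta>\<^sup>2 * vY = \<beta> * vY"
proof -
  have "1 - \<beta> = vY / (v1 + vY)" using assms by (simp add: field_simps)
  moreover have "v1 + vY \<noteq> 0" using assms by simp
  ultimately show ?thesis
    by (simp add: \<beta> divide_simps) (simp add: power2_eq_square algebra_simps)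
qed

theorem theorem4p3:
  fixes \<sigma>1 \<sigma>2 \<sigma>Y a1 a2 aY :: real
  assumes "\<sigma>1\<^sup>2 > 0" and "\<sigma>2\<^sup>2 > 0" and "\<sigma>Y\<^sup>2 > 0"
    and "a1\<^sup>2 > 0" and "a2\<^sup>2 > 0" and "aY\<^sup>2 > 0"
  shows
    "let A = {0..};
         \<beta> = \<sigma>1\<^sup>2 / (\<sigma>1\<^sup>2 + \<sigma>Y\<^sup>2);
         \<sigma>U2 = (a2\<^sup>2 * \<sigma>2\<^sup>2 + (1 - \<beta>)\<^sup>2 * a1\<^sup>2 * \<sigma>1\<^sup>2 + \<beta>\<^sup>2 * aY\<^sup>2 * \<sigma>Y\<^sup>2) / (\<sigma>2\<^sup>2 + \<beta> * \<sigma>Y\<^sup>2);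
         \<sigma>V2 = (a1\<^sup>2 * \<sigma>1\<^sup>2 + a2\<^sup>2 * \<sigma>2\<^sup>2) / (\<sigma>1\<^sup>2 + \<sigma>2\<^sup>2);
         dominance = dominates (parameter_space A)
           (kl_risk (a1\<^sup>2 * \<sigma>1\<^sup>2) (a2\<^sup>2 * \<sigma>2\<^sup>2) (aY\<^sup>2 * \<sigma>Y\<^sup>2))
           (q_bayes (uniform_prior A) (\<sigma>1\<^sup>2) (\<sigma>2\<^sup>2) (\<sigma>Y\<^sup>2))
           (q_mre (\<sigma>1\<^sup>2) (\<sigma>Y\<^sup>2))
     in (\<sigma>U2 \<le> \<sigma>V2 \<longrightarrow> dominance) \<and>
        (a1\<^sup>2 = a2\<^sup>2 \<and> a2\<^sup>2 = aY\<^sup>2 \<longrightarrow> dominance) \<and>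
        (aY\<^sup>2 \<le> a1\<^sup>2 \<and> a1\<^sup>2 = a2\<^sup>2 \<longrightarrow> dominance) \<and>
        (\<sigma>1\<^sup>2 = \<sigma>2\<^sup>2 \<and> \<sigma>2\<^sup>2 = \<sigma>Y\<^sup>2 \<and> (a2\<^sup>2 + aY\<^sup>2) / 2 \<le> a1\<^sup>2 \<longrightarrow> dominance)"
proof -
  define A :: "real set" where "A = {0..}"
  define \<beta> where "\<beta> = \<sigma>1\<^sup>2 / (\<sigma>1\<^sup>2 + \<sigma>Y\<^sup>2)"
  define \<sigma>U2 where "\<sigma>U2 = (a2\<^sup>2 * \<sigma>2\<^sup>2 + (1 - \<beta>)\<^sup>2 * a1\<^sup>2 * \<sigma>1\<^sup>2 + \<beta>\<^sup>2 * aY\<^sup>2 * \<sigma>Y\<^sup>2) / (\<sigma>2\<^sup>2 + \<beta> * \<sigma>Y\<^sup>2)"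
  define \<sigma>V2 where "\<sigma>V2 = (a1\<^sup>2 * \<sigma>1\<^sup>2 + a2\<^sup>2 * \<sigma>2\<^sup>2) / (\<sigma>1\<^sup>2 + \<sigma>2\<^sup>2)"
  define dominance where "dominance \<longleftrightarrow> dominates (parameter_space A)
    (kl_risk (a1\<^sup>2 * \<sigma>1\<^sup>2) (a2\<^sup>2 * \<sigma>2\<^sup>2) (aY\<^sup>2 * \<sigma>Y\<^sup>2))
    (q_bayes (uniform_prior A) (\<sigma>1\<^sup>2) (\<sigma>2\<^sup>2) (\<sigma>Y\<^sup>2))
    (q_mre (\<sigma>1\<^sup>2) (\<sigma>Y\<^sup>2))"
  note pos = assms
  have "\<beta> > 0" unfolding \<beta>_def using pos by (intro divide_pos_pos add_pos_pos)
  have main: dominance if "\<sigma>U2 \<le> \<sigma>V2"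
    unfolding dominance_def A_def
  proof (rule q_bayes_dominates_q_mre[OF pos(1-3) _ _ _ \<beta>_def])
    show "(a2\<^sup>2 * \<sigma>2\<^sup>2 + (1 - \<beta>)\<^sup>2 * (a1\<^sup>2 * \<sigma>1\<^sup>2) + \<beta>\<^sup>2 * (aY\<^sup>2 * \<sigma>Y\<^sup>2)) / (\<sigma>2\<^sup>2 + \<beta> * \<sigma>Y\<^sup>2)
        \<le> (a1\<^sup>2 * \<sigma>1\<^sup>2 + a2\<^sup>2 * \<sigma>2\<^sup>2) / (\<sigma>1\<^sup>2 + \<sigma>2\<^sup>2)"
      using that by (simp only: \<sigma>U2_def \<sigma>V2_def mult.assoc)
  qed (intro mult_pos_pos pos)+
  have case_ii: dominance if "aY\<^sup>2 \<le> a1\<^sup>2" "a1\<^sup>2 = a2\<^sup>2"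
  proof (rule main)
    have "\<sigma>2\<^sup>2 + \<beta> * \<sigma>Y\<^sup>2 > 0" using pos \<open>\<beta> > 0\<close> by (intro add_pos_pos mult_pos_pos)
    moreover have "\<beta>\<^sup>2 * aY\<^sup>2 * \<sigma>Y\<^sup>2 \<le> \<beta>\<^sup>2 * a1\<^sup>2 * \<sigma>Y\<^sup>2"
      using that(1) by (intro mult_right_mono mult_left_mono) auto
    then have "a2\<^sup>2 * \<sigma>2\<^sup>2 + (1 - \<beta>)\<^sup>2 * a1\<^sup>2 * \<sigma>1\<^sup>2 + \<beta>\<^sup>2 * aY\<^sup>2 * \<sigma>Y\<^sup>2
      \<le> a1\<^sup>2 * (\<sigma>2\<^sup>2 + ((1 - \<beta>)\<^sup>2 * \<sigma>1\<^sup>2 + \<beta>\<^sup>2 * \<sigma>Y\<^sup>2))"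
      using that(2) by (simp add: algebra_simps)
    ultimately have "\<sigma>U2 \<le> a1\<^sup>2"
      unfolding shrunk_variance_eq[OF pos(1,3) \<beta>_def] \<sigma>U2_def
      by (simp add: pos_divide_le_eq mult.commute)
    also have "a1\<^sup>2 = \<sigma>V2"
      using pos(1,2) that(2) by (simp add: \<sigma>V2_def flip: distrib_left)
    finally show "\<sigma>U2 \<le> \<sigma>V2" .
  qed
  have case_iii: dominance if "\<sigma>1\<^sup>2 = \<sigma>2\<^sup>2" "\<sigma>2\<^sup>2 = \<sigma>Y\<^sup>2" "(a2\<^sup>2 + aY\<^sup>2) / 2 \<le> a1\<^sup>2"
  proof (rule main)
    have \<beta>: "\<beta> = 1 / 2" using pos(1) that by (simp add: \<beta>_def)
    have "(A * s + (1 - 1 / 2)\<^sup>2 * B * s + (1 / 2)\<^sup>2 * C * s) / (s + 1 / 2 * s) = (4 * A + B + C) / 6"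
      if "s > 0" for A B C s :: real
      using that by (simp add: power2_eq_square field_simps)
    from this[OF pos(3)] have U: "\<sigma>U2 = (4 * a2\<^sup>2 + a1\<^sup>2 + aY\<^sup>2) / 6"
      unfolding \<sigma>U2_def \<beta> that(1,2) .
    have "(B * s + A * s) / (s + s) = (B + A) / 2" if "s > 0" for A B s :: real
      using that by (simp add: field_simps)
    from this[OF pos(3)] have V: "\<sigma>V2 = (a1\<^sup>2 + a2\<^sup>2) / 2"
      unfolding \<sigma>V2_def that(1,2) .
    show "\<sigma>U2 \<le> \<sigma>V2" using that(3) unfolding U V by simp
  qed
  \<comment> \<open>Case (i) is the instance of case (ii) with equality.\<close>
  show ?thesis
    unfolding Let_def A_def[symmetric] \<beta>_def[symmetric]
    unfolding \<sigma>U2_def[symmetric] \<sigma>V2_def[symmetric] dominance_def[symmetric]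
    using main case_ii case_iii by auto
qed

end
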